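(* Let $d\geq 2$ and $n\geq 1$ be integers. Let $B(d,n)$ be the de Bruijn digraph and $K(d,n)$ the Kautz digraph. Then (i) $\mu(B(d,n))=d^{n-1}(d-1)$; (ii) $\mu(K(d,n))=d$ if $n=1$, and $\mu(K(d,n))=d^{n-2}(d^{2}-1)$ if $n\geq 2$.
   Context: The line graph $L(G)$ of a digraph $G$ (loops allowed, no multiple edges) is the digraph whose vertices are the directed edges of $G$, and in which $(a,b)$, with $a=(x_1,x_2)$ and $b=(y_1,y_2)$ in $E(G)$, is a directed edge if and only if $x_2=y_1$. $K_d$ denotes the complete digraph with $d$ vertices (all ordered pairs of distinct vertices are edges), and $K_d^+$ denotes the flowered complete digraph of order $d$, obtained from $K_d$ by appending a self-loop at each vertex. The de Bruijn digraphs are defined by $B(d,1)=K_d^+$ and $B(d,n)=L(B(d,n-1))$ for $n\ge 2$; the Kautz digraphs are defined by $K(d,1)=K_{d+1}$ and $K(d,n)=L(K(d,n-1))$ for $n\geq 2$. The distance $d_H(u,v)$ from $u$ to $v$ in a strongly connected digraph $H$ is the length of a shortest directed path from $u$ to $v$ (with $d_H(u,u)=0$). A resolving set of $H$ is a set $W=\{w_1,\ldots,w_m\}$ of vertices such that each vertex $u$ of $H$ is uniquely determined by the vector $(d_H(u,w_1),\ldots,d_H(u,w_m))$, i.e. distinct vertices have distinct vectors. The metric dimension $\mu(H)$ is the minimum cardinality of a resolving set of $H$. *)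

theory Defs
  imports "Graph_Theory.Graph_Theory" "HOL-Library.Extended_Nat"
begin

definition line_digraph :: "'a pair_pre_digraph \<Rightarrow> ('a \<times> 'a) pair_pre_digraph" where
  "line_digraph G = \<lparr> pverts = parcs G,
     parcs = {(a, b). a \<in> parcs G \<and> b \<in> parcs G \<and> snd a = fst b} \<rparr>"

text \<open>
  Taking the line digraph changes the vertex type from \<open>'a\<close> to \<open>'a \<times> 'a\<close>, so it cannot be
  iterated a variable number of times as it stands. The type below contains an injective copy of
  its own pairs; \<open>line\<close> is the line digraph with every vertex \<open>(x, y)\<close> renamed to \<open>Edge x y\<close>.
\<close>

datatype vertex = Letter nat | Edge vertex vertex

definition rename_verts :: "('a \<Rightarrow> 'b) \<Rightarrow> 'a pair_pre_digraph \<Rightarrow> 'b pair_pre_digraph" where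
  "rename_verts f G = \<lparr> pverts = f ` pverts G, parcs = map_prod f f ` parcs G \<rparr>"

definition line :: "vertex pair_pre_digraph \<Rightarrow> vertex pair_pre_digraph" where
  "line G = rename_verts (\<lambda>(x, y). Edge x y) (line_digraph G)"

lemma inj_Edge: "inj (\<lambda>(x, y). Edge x y)"
  by (auto simp: inj_on_def)

definition complete_on_letters :: "nat \<Rightarrow> vertex pair_pre_digraph" where
  "complete_on_letters d = \<lparr> pverts = Letter ` {..<d},
     parcs = {(u, v). u \<in> Letter ` {..<d} \<and> v \<in> Letter ` {..<d} \<and> u \<noteq> v} \<rparr>"

lemma complete_digraph_complete_on_letters:
  "complete_digraph d (with_proj (complete_on_letters d))"
  unfolding complete_digraph_pair_def
  by (auto simp: complete_on_letters_def card_image inj_on_def)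

definition add_loops :: "'a pair_pre_digraph \<Rightarrow> 'a pair_pre_digraph" where
  "add_loops G = \<lparr> pverts = pverts G, parcs = parcs G \<union> Id_on (pverts G) \<rparr>"

text \<open>Both families are indexed from 1; nothing is specified for index 0.\<close>

fun de_bruijn :: "nat \<Rightarrow> nat \<Rightarrow> vertex pair_pre_digraph" where
  "de_bruijn d (Suc 0) = add_loops (complete_on_letters d)"
| "de_bruijn d (Suc (Suc n)) = line (de_bruijn d (Suc n))"

fun kautz :: "nat \<Rightarrow> nat \<Rightarrow> vertex pair_pre_digraph" where
  "kautz d (Suc 0) = complete_on_letters (d + 1)"
| "kautz d (Suc (Suc n)) = line (kautz d (Suc n))"

text \<open>The distance is \<open>\<infinity>\<close> if there is no path, which does not happen in strongly connected digraphs.\<close>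

definition distance :: "('a, 'b) pre_digraph \<Rightarrow> 'a \<Rightarrow> 'a \<Rightarrow> enat" where
  "distance H u v = (INF p \<in> {p. pre_digraph.apath H u p v}. enat (length p))"

definition resolving_set :: "('a, 'b) pre_digraph \<Rightarrow> 'a set \<Rightarrow> bool" where
  "resolving_set H W \<longleftrightarrow> finite W \<and> W \<subseteq> verts H \<and>
     (\<forall>u \<in> verts H. \<forall>v \<in> verts H. (\<forall>w \<in> W. distance H u w = distance H v w) \<longrightarrow> u = v)"

definition metric_dimension :: "('a, 'b) pre_digraph \<Rightarrow> nat" where
  "metric_dimension H = (LEAST m. \<exists>W. resolving_set H W \<and> card W = m)"

end

theory Submission
  imports Defs
begin

text \<open>
  Two vertices with the same out-neighbours are separated only by themselves, so a resolving set
  omits at most one vertex from each class of such twins. In a line digraph the classes are the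
  sets of arcs of \<open>G\<close> with a common head, which gives the lower bound \<open>|E(G)| - |V(G)|\<close>. It is
  attained by omitting one arc \<open>(p v, v)\<close> for each vertex \<open>v\<close>, provided that every vertex \<open>u\<close>
  keeps some outgoing arc: two omitted arcs with different heads \<open>u\<close> and \<open>v\<close> are then separated by
  a kept arc leaving \<open>u\<close>. If \<open>G\<close> is itself a line digraph, such a \<open>p\<close> is obtained at each vertex
  by a non-constant map from its outgoing to its incoming arcs.
\<close>

section \<open>Distances and twins\<close>

lemma (in wf_digraph) awalk_imp_shorter_apath:
  assumes "awalk u p v"
  shows "\<exists>q. apath u q v \<and> length q \<le> length p"
  using assms
proof (induct rule: awalk_to_apath_induct)
  case (path p)
  then show ?case by (auto simp: apath_def)
next
  case (decomp p q r s)
  then have "p = q @ r @ s" by (auto elim: awalk_cyc_decompE)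
  with decomp show ?case by (force intro: le_trans)
qed

text \<open>\<open>distance\<close> ranges over paths without repeated vertices, but rerouting the
  start of a path may create a repetition. This bound lets any walk witness an upper
  estimate.\<close>

lemma (in wf_digraph) distance_le_awalk:
  assumes "awalk u p v"
  shows "distance G u v \<le> enat (length p)"
proof -
  obtain q where "apath u q v" "length q \<le> length p"
    using awalk_imp_shorter_apath[OF assms] by blast
  then show ?thesis
    unfolding distance_def by (auto intro: INF_lower2)
qed

lemma distance_less_iff:
  "distance G u v < enat k \<longleftrightarrow> (\<exists>p. pre_digraph.apath G u p v \<and> length p < k)"
  by (auto simp: distance_def INF_less_iff)

lemma (in pair_wf_digraph) distance_eq_0_iff:
  assumes "u \<in> pverts G"
  shows "distance G u v = 0 \<longleftrightarrow> u = v"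
proof -
  have "distance G u v = 0 \<longleftrightarrow> distance G u v < enat 1"
    by (cases "distance G u v") (auto simp: zero_enat_def)
  then show ?thesis
    using assms by (auto simp: distance_less_iff apath_Nil_iff)
qed

lemma (in pair_wf_digraph) distance_less_2_iff:
  assumes "u \<noteq> v"
  shows "distance G u v < enat 2 \<longleftrightarrow> (u, v) \<in> parcs G"
proof
  assume "distance G u v < enat 2"
  then obtain p where "apath u p v" "length p < 2"
    by (auto simp: distance_less_iff)
  then show "(u, v) \<in> parcs G"
    using assms by (cases p) (auto simp: apath_simps)
next
  assume uv: "(u, v) \<in> parcs G"
  then have "apath u [(u, v)] v"
    using assms by (auto simp: apath_simps dest: in_arcsD2)
  then show "distance G u v < enat 2"
    by (force simp: distance_less_iff)
qed

text \<open>Redirect the first arc of a path from \<open>u\<close> so that it starts at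
  \<open>v\<close>, or drop it if it already leads to \<open>v\<close>. As \<open>w\<close> is not
  \<open>u\<close>, there is a first arc. Exempting \<open>u\<close> and \<open>v\<close> as heads
  makes any two vertices of a complete digraph twins, with or without loops.\<close>

lemma (in pair_wf_digraph) distance_le_twin:
  assumes twin: "\<And>x. (u, x) \<in> parcs G \<Longrightarrow> x \<noteq> u \<Longrightarrow> x \<noteq> v \<Longrightarrow> (v, x) \<in> parcs G"
    and "w \<noteq> u"
  shows "distance G v w \<le> distance G u w"
  unfolding distance_def[of _ u]
proof (rule INF_greatest)
  fix p assume "p \<in> {p. apath u p w}"
  then have p: "apath u p w" by simp
  with \<open>w \<noteq> u\<close> obtain x p' where x: "p = (u, x) # p'" "(u, x) \<in> parcs G" "apath x p' w"
    by (cases p) (auto simp: apath_simps)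
  then have "x \<noteq> u"
    using no_loops_in_apath[OF p, of "(u, x)"] by simp
  have "\<exists>q. awalk v q w \<and> length q \<le> length p"
  proof (cases "x = v")
    case True
    then show ?thesis
      using x by (intro exI[of _ p']) (auto simp: apath_def)
  next
    case False
    then show ?thesis
      using x \<open>x \<noteq> u\<close> twin by (intro exI[of _ "(v, x) # p'"]) (auto simp: apath_def awalk_Cons_iff)
  qed
  then show "distance G v w \<le> enat (length p)"
    using distance_le_awalk by (metis enat_ord_simps(1) order_trans)
qed

lemma (in pair_fin_digraph) metric_dimension_eq_card_minus_classes:
  fixes h :: "'a \<Rightarrow> 'b" and s :: "'b \<Rightarrow> 'a"
  assumes h: "h ` pverts G \<subseteq> K"
    and twins: "\<And>u v x. \<lbrakk>u \<in> pverts G; v \<in> pverts G; h u = h v; (u, x) \<in> parcs G; x \<noteq> u; x \<noteq> v\<rbrakk>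
      \<Longrightarrow> (v, x) \<in> parcs G"
    and s: "\<And>k. k \<in> K \<Longrightarrow> s k \<in> pverts G \<and> h (s k) = k"
    and separated: "\<And>k l. \<lbrakk>k \<in> K; l \<in> K; k \<noteq> l\<rbrakk>
      \<Longrightarrow> \<exists>w \<in> pverts G - s ` K. (s k, w) \<in> parcs G \<and> (s l, w) \<notin> parcs G"
  shows "metric_dimension G = card (pverts G) - card K"
  unfolding metric_dimension_def
proof (rule Least_equality)
  have K: "s ` K \<subseteq> pverts G" "inj_on s K"
    using s by (auto intro: inj_on_inverseI[of _ h])
  then have "finite K"
    using pair_finite_verts by (meson finite_imageD finite_subset)
  then have "card (pverts G - s ` K) = card (pverts G) - card K"
    using K by (simp add: card_Diff_subset card_image)
  moreover have "resolving_set G (pverts G - s ` K)"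
    unfolding resolving_set_def
  proof (intro conjI ballI impI)
    fix u v
    assume uv: "u \<in> verts G" "v \<in> verts G"
      and eq: "\<forall>w \<in> pverts G - s ` K. distance G u w = distance G v w"
    show "u = v"
    proof (rule ccontr)
      assume "u \<noteq> v"
      \<comment> \<open>A vertex in the set is told apart from all others by its distance 0 to
        itself, so only two omitted vertices could be confused.\<close>
      then have "distance G u v \<noteq> distance G v v" "distance G u u \<noteq> distance G v u"
        using uv by (metis distance_eq_0_iff with_proj_simps(1))+
      then have "u \<in> s ` K" "v \<in> s ` K"
        using uv eq by auto
      then obtain k l where kl: "u = s k" "v = s l" "k \<in> K" "l \<in> K" by blast
      with \<open>u \<noteq> v\<close> obtain w where w: "w \<in> pverts G - s ` K" "(u, w) \<in> parcs G" "(v, w) \<notin> parcs G"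
        using separated by blast
      \<comment> \<open>\<open>w\<close> is kept while \<open>u\<close> and \<open>v\<close> are
        omitted; hence distance below 2 to \<open>w\<close> means adjacency, which holds for
        \<open>u\<close> only.\<close>
      then have "u \<noteq> w" "v \<noteq> w" using kl by auto
      then show False
        using w eq distance_less_2_iff[of u w] distance_less_2_iff[of v w] by simp
    qed
  qed (use pair_finite_verts in auto)
  ultimately show "\<exists>W. resolving_set G W \<and> card W = card (pverts G) - card K" by blast
  fix m
  assume "\<exists>W. resolving_set G W \<and> card W = m"
  then obtain W where W: "resolving_set G W" "card W = m" by blast
  have "inj_on h (pverts G - W)"
  proof (rule inj_onI)
    fix u v
    assume uv: "u \<in> pverts G - W" "v \<in> pverts G - W" "h u = h v"
    have "distance G u w = distance G v w" if "w \<in> W" for w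
      using that uv by (intro antisym distance_le_twin) (auto intro: twins[of u v] twins[of v u])
    then show "u = v"
      using W(1) uv by (auto simp: resolving_set_def)
  qed
  then have "card (pverts G - W) \<le> card K"
    using h \<open>finite K\<close> by (intro card_inj_on_le) auto
  moreover have "card (pverts G - W) = card (pverts G) - m"
    using W by (auto simp: resolving_set_def card_Diff_subset)
  ultimately show "card (pverts G) - card K \<le> m" by linarith
qed

text \<open>All vertices form a single twin class, so one vertex is omitted and there is no pair of
  classes to separate.\<close>

lemma (in pair_fin_digraph) metric_dimension_complete:
  assumes "pverts G \<noteq> {}"
    and "\<And>u v. \<lbrakk>u \<in> pverts G; v \<in> pverts G; u \<noteq> v\<rbrakk> \<Longrightarrow> (u, v) \<in> parcs G"
  shows "metric_dimension G = card (pverts G) - 1"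
proof -
  obtain a where "a \<in> pverts G" using assms(1) by blast
  then have "metric_dimension G = card (pverts G) - card {()}"
    by (intro metric_dimension_eq_card_minus_classes[where h = "\<lambda>_. ()" and s = "\<lambda>_. a"])
      (auto intro!: assms(2) dest: in_arcsD2)
  then show ?thesis by simp
qed

section \<open>Line digraphs of regular digraphs\<close>

lemma pverts_line: "pverts (line G) = (\<lambda>(x, y). Edge x y) ` parcs G"
  by (auto simp: line_def rename_verts_def line_digraph_def)

lemma parcs_line:
  "parcs (line G) = {(Edge x y, Edge y z) |x y z. (x, y) \<in> parcs G \<and> (y, z) \<in> parcs G}"
  by (force simp: line_def rename_verts_def line_digraph_def)

lemma card_pverts_line: "card (pverts (line G)) = card (parcs G)"
  by (simp add: pverts_line card_image inj_on_subset[OF inj_Edge])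

lemma Edge_in_pverts_line [simp]: "Edge x y \<in> pverts (line G) \<longleftrightarrow> (x, y) \<in> parcs G"
  by (force simp: pverts_line)

lemma Edge_in_parcs_line [simp]:
  "(Edge x y, e) \<in> parcs (line G) \<longleftrightarrow> (\<exists>z. e = Edge y z \<and> (x, y) \<in> parcs G \<and> (y, z) \<in> parcs G)"
  by (auto simp: parcs_line)

lemma pair_fin_digraph_line:
  assumes "pair_fin_digraph G"
  shows "pair_fin_digraph (line G)"
proof -
  interpret pair_fin_digraph G by fact
  have "parcs (line G) \<subseteq> pverts (line G) \<times> pverts (line G)"
    by (auto simp: parcs_line)
  moreover have "finite (pverts (line G))"
    using pair_finite_arcs by (simp add: pverts_line)
  ultimately show ?thesis
    by unfold_locales (auto intro: finite_subset)
qed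

text \<open>\<open>(p v, v)\<close> is the arc into \<open>v\<close> to be omitted; the second
  clause leaves every vertex an outgoing arc that is not omitted.\<close>

definition sparing_choice :: "('a \<Rightarrow> 'a) \<Rightarrow> 'a pair_pre_digraph \<Rightarrow> bool" where
  "sparing_choice p G \<longleftrightarrow> (\<forall>v \<in> pverts G. (p v, v) \<in> parcs G) \<and>
     (\<forall>u \<in> pverts G. \<exists>v. (u, v) \<in> parcs G \<and> p v \<noteq> u)"

lemma metric_dimension_line:
  assumes "pair_fin_digraph G" and p: "sparing_choice p G"
  shows "metric_dimension (line G) = card (parcs G) - card (pverts G)"
proof -
  interpret pair_fin_digraph G by fact
  interpret L: pair_fin_digraph "line G"
    using assms(1) by (rule pair_fin_digraph_line)
  have "metric_dimension (line G) = card (pverts (line G)) - card (pverts G)"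
  \<comment> \<open>An arc is labelled by its head. The \<open>Letter\<close> branch is a mere
    default, since every vertex of \<open>line G\<close> is an \<open>Edge\<close>.\<close>
  proof (rule L.metric_dimension_eq_card_minus_classes
      [where h = "\<lambda>e. case e of Edge x y \<Rightarrow> y | Letter _ \<Rightarrow> e" and s = "\<lambda>v. Edge (p v) v"])
    fix k l
    assume kl: "k \<in> pverts G" "l \<in> pverts G" "k \<noteq> l"
    \<comment> \<open>The kept arc from \<open>k\<close> to \<open>z\<close> follows every arc into
      \<open>k\<close> and no arc into \<open>l\<close>, so it separates the two omitted
      arcs.\<close>
    then obtain z where "(k, z) \<in> parcs G" "p z \<noteq> k"
      using p unfolding sparing_choice_def by blast
    then show "\<exists>w \<in> pverts (line G) - (\<lambda>v. Edge (p v) v) ` pverts G.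
        (Edge (p k) k, w) \<in> parcs (line G) \<and> (Edge (p l) l, w) \<notin> parcs (line G)"
      using kl p by (intro bexI[of _ "Edge k z"]) (auto simp: sparing_choice_def)
  qed (use p in \<open>auto simp: pverts_line sparing_choice_def dest: in_arcsD2\<close>)
  then show ?thesis by (simp add: card_pverts_line)
qed

definition regular_digraph :: "nat \<Rightarrow> 'a pair_pre_digraph \<Rightarrow> bool" where
  "regular_digraph d G \<longleftrightarrow> pair_fin_digraph G \<and>
     (\<forall>v \<in> pverts G. card (parcs G `` {v}) = d \<and> card ((parcs G)\<inverse> `` {v}) = d)"

lemma card_parcs_regular:
  assumes "regular_digraph d G"
  shows "card (parcs G) = d * card (pverts G)"
proof -
  interpret pair_fin_digraph G using assms by (simp add: regular_digraph_def)
  have "parcs G = (SIGMA v : pverts G. parcs G `` {v})"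
    by (auto dest: in_arcsD1)
  moreover have "card (SIGMA v : pverts G. parcs G `` {v}) = d * card (pverts G)"
    using assms pair_finite_verts pair_finite_arcs
    by (subst card_SigmaI) (auto simp: regular_digraph_def intro: finite_Image)
  ultimately show ?thesis by simp
qed

lemma regular_digraph_line:
  assumes "regular_digraph d G"
  shows "regular_digraph d (line G)"
  unfolding regular_digraph_def
proof (intro conjI ballI)
  interpret pair_fin_digraph G using assms by (simp add: regular_digraph_def)
  show "pair_fin_digraph (line G)"
    by (rule pair_fin_digraph_line) unfold_locales
  fix e assume "e \<in> pverts (line G)"
  then obtain x y where xy: "e = Edge x y" "(x, y) \<in> parcs G" by (auto simp: pverts_line)
  then have "parcs (line G) `` {e} = Edge y ` (parcs G `` {y})"
    and "(parcs (line G))\<inverse> `` {e} = (\<lambda>w. Edge w x) ` ((parcs G)\<inverse> `` {x})"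
    by (auto simp: parcs_line)
  moreover have "x \<in> pverts G" "y \<in> pverts G"
    using xy by (auto dest: in_arcsD1 in_arcsD2)
  ultimately show "card (parcs (line G) `` {e}) = d" "card ((parcs (line G))\<inverse> `` {e}) = d"
    using assms by (simp_all add: regular_digraph_def card_image inj_on_def)
qed

text \<open>With degrees at least 2, each vertex \<open>x\<close> has distinct in-neighbours
  \<open>i x\<close>, \<open>j x\<close> and distinct out-neighbours \<open>k x\<close>,
  \<open>l x\<close>. Assigning the arc from \<open>i x\<close> to the outgoing arc towards
  \<open>k x\<close>, and the arc from \<open>j x\<close> to all others, gives a non-constant
  map.\<close>

lemma sparing_choice_line:
  assumes "regular_digraph d G" and "d \<ge> 2"
  shows "\<exists>p. sparing_choice p (line G)"
proof -
  interpret pair_fin_digraph G using assms by (simp add: regular_digraph_def)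
  have two: "\<exists>a b. a \<in> A \<and> b \<in> A \<and> a \<noteq> b" if "card A = d" for A :: "vertex set"
    using that assms(2) card_2_iff' by (metis card_le_Suc0_iff_eq card.infinite not_less_eq_eq
        numeral_2_eq_2 not_numeral_le_zero)
  have "\<exists>i j k l. (i, x) \<in> parcs G \<and> (j, x) \<in> parcs G \<and> i \<noteq> j \<and>
      (x, k) \<in> parcs G \<and> (x, l) \<in> parcs G \<and> k \<noteq> l" if "x \<in> pverts G" for x
    using that assms(1) two[of "parcs G `` {x}"] two[of "(parcs G)\<inverse> `` {x}"]
    by (force simp: regular_digraph_def)
  then obtain i j k l where ijkl: "\<And>x. x \<in> pverts G \<Longrightarrow>
      (i x, x) \<in> parcs G \<and> (j x, x) \<in> parcs G \<and> i x \<noteq> j x \<and>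
      (x, k x) \<in> parcs G \<and> (x, l x) \<in> parcs G \<and> k x \<noteq> l x"
    by metis
  define p where "p e = (case e of Edge x y \<Rightarrow> Edge (if y = k x then i x else j x) x | Letter _ \<Rightarrow> e)"
    for e
  have "sparing_choice p (line G)"
    unfolding sparing_choice_def
  proof (intro conjI ballI)
    fix e assume "e \<in> pverts (line G)"
    then obtain x y where xy: "e = Edge x y" "(x, y) \<in> parcs G" by (auto simp: pverts_line)
    then have "x \<in> pverts G" by (auto dest: in_arcsD1)
    then show "(p e, e) \<in> parcs (line G)"
      using xy ijkl by (auto simp: p_def)
  next
    fix e assume "e \<in> pverts (line G)"
    then obtain w x where wx: "e = Edge w x" "(w, x) \<in> parcs G" by (auto simp: pverts_line)
    then have x: "x \<in> pverts G" by (auto dest: in_arcsD2)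
    show "\<exists>v. (e, v) \<in> parcs (line G) \<and> p v \<noteq> e"
    \<comment> \<open>The arc towards \<open>l x\<close> was assigned \<open>j x\<close>, and the
      one towards \<open>k x\<close> was assigned \<open>i x\<close>; take the one whose assigned
      tail is not \<open>w\<close>.\<close>
    proof (cases "w = i x")
      case True
      then show ?thesis
        using wx ijkl[OF x] by (intro exI[of _ "Edge x (l x)"]) (auto simp: p_def)
    next
      case False
      then show ?thesis
        using wx ijkl[OF x] by (intro exI[of _ "Edge x (k x)"]) (auto simp: p_def)
    qed
  qed
  then show ?thesis by blast
qed

section \<open>De Bruijn and Kautz digraphs\<close>

text \<open>Regularity, the vertex count and the existence of a choice pass together from each
  digraph to its line digraph. The choice on \<open>F 1\<close> is a hypothesis because
  \<open>F 1\<close> need not be a line digraph.\<close>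

lemma iterated_line:
  assumes F: "\<And>n. F (Suc (Suc n)) = line (F (Suc n))"
    and reg: "regular_digraph d (F 1)" and "d \<ge> 2"
    and p: "sparing_choice p (F 1)"
  shows "metric_dimension (F (Suc (Suc n))) = d ^ n * (d - 1) * card (pverts (F 1))"
proof -
  have *: "regular_digraph d (F (Suc n)) \<and> card (pverts (F (Suc n))) = d ^ n * card (pverts (F 1)) \<and>
      (\<exists>p. sparing_choice p (F (Suc n)))"
  proof (induction n)
    case 0
    then show ?case using reg p by auto
  next
    case (Suc n)
    then show ?case
      using regular_digraph_line sparing_choice_line[OF _ \<open>d \<ge> 2\<close>]
      by (auto simp: F card_pverts_line card_parcs_regular)
  qed
  then obtain q where "sparing_choice q (F (Suc n))" by blast
  then have "metric_dimension (F (Suc (Suc n))) = card (parcs (F (Suc n))) - card (pverts (F (Suc n)))"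
    using * metric_dimension_line[of "F (Suc n)" q] by (simp add: F regular_digraph_def)
  also have "\<dots> = (d - 1) * card (pverts (F (Suc n)))"
    using card_parcs_regular[OF conjunct1[OF *]] by (simp add: diff_mult_distrib)
  finally show ?thesis using * by simp
qed

lemma pair_fin_digraph_complete_on_letters: "pair_fin_digraph (complete_on_letters d)"
proof unfold_locales
  show "finite (parcs (complete_on_letters d))"
    by (rule finite_subset[of _ "Letter ` {..<d} \<times> Letter ` {..<d}"])
      (auto simp: complete_on_letters_def)
qed (auto simp: complete_on_letters_def)

lemma pair_fin_digraph_add_loops:
  assumes "pair_fin_digraph G"
  shows "pair_fin_digraph (add_loops G)"
proof -
  interpret pair_fin_digraph G by fact
  have "finite (Id_on (pverts G))"
    using pair_finite_verts by (simp add: Id_on_def)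
  then show ?thesis
    using pair_finite_verts pair_finite_arcs
    by unfold_locales (auto simp: add_loops_def dest: in_arcsD1 in_arcsD2)
qed

lemma card_pverts_complete_on_letters: "card (pverts (complete_on_letters d)) = d"
  by (simp add: complete_on_letters_def card_image inj_on_def)

lemma pverts_add_loops [simp]: "pverts (add_loops G) = pverts G"
  by (simp add: add_loops_def)

lemma regular_complete_on_letters: "regular_digraph d (complete_on_letters (d + 1))"
proof -
  have "card (parcs (complete_on_letters (d + 1)) `` {v}) = d"
    "card ((parcs (complete_on_letters (d + 1)))\<inverse> `` {v}) = d"
    if "v \<in> pverts (complete_on_letters (d + 1))" for v
  proof -
    have "parcs (complete_on_letters (d + 1)) `` {v} = pverts (complete_on_letters (d + 1)) - {v}"
      "(parcs (complete_on_letters (d + 1)))\<inverse> `` {v} = pverts (complete_on_letters (d + 1)) - {v}"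
      using that by (auto simp: complete_on_letters_def)
    then show "card (parcs (complete_on_letters (d + 1)) `` {v}) = d"
      "card ((parcs (complete_on_letters (d + 1)))\<inverse> `` {v}) = d"
      using that by (simp_all add: card_Diff_singleton card_pverts_complete_on_letters)
  qed
  then show ?thesis
    by (simp add: regular_digraph_def pair_fin_digraph_complete_on_letters)
qed

lemma regular_add_loops_complete: "regular_digraph d (add_loops (complete_on_letters d))"
proof -
  let ?G = "add_loops (complete_on_letters d)"
  have "parcs ?G `` {v} = pverts ?G" "(parcs ?G)\<inverse> `` {v} = pverts ?G" if "v \<in> pverts ?G" for v
    using that by (auto simp: add_loops_def complete_on_letters_def)
  then show ?thesis
    by (simp add: regular_digraph_def pair_fin_digraph_add_loops
        pair_fin_digraph_complete_on_letters card_pverts_complete_on_letters)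
qed

text \<open>Omitting the loops leaves each letter its arcs to the other letters.\<close>

lemma sparing_choice_add_loops_complete:
  assumes "d \<ge> 2"
  shows "sparing_choice id (add_loops (complete_on_letters d))"
proof -
  have "\<exists>b < d. b \<noteq> a" for a
    using assms by (intro exI[of _ "if a = 0 then 1 else 0"]) auto
  then show ?thesis
    unfolding sparing_choice_def
    by (auto simp: add_loops_def complete_on_letters_def Bex_def image_iff)
qed

text \<open>The map runs through the cycle 0, 1, 2 and sends every further letter to 0. It has no
  fixed point, as loops are absent, and no 2-cycle.\<close>

lemma sparing_choice_complete_on_letters:
  assumes "d \<ge> 3"
  shows "sparing_choice
    (\<lambda>v. Letter (if v = Letter 0 then 1 else if v = Letter 1 then 2 else 0))
    (complete_on_letters d)" (is "sparing_choice ?p ?G")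
  unfolding sparing_choice_def
proof (intro conjI ballI)
  fix v assume "v \<in> pverts ?G"
  then show "(?p v, v) \<in> parcs ?G"
    using assms by (auto simp: complete_on_letters_def)
next
  fix u assume "u \<in> pverts ?G"
  then obtain a where "u = Letter a" "a < d" by (auto simp: complete_on_letters_def)
  then show "\<exists>v. (u, v) \<in> parcs ?G \<and> ?p v \<noteq> u"
    using assms
    \<comment> \<open>The witness is \<open>?p u\<close> itself: the absence of 2-cycles gives
      \<open>?p (?p u) \<noteq> u\<close>.\<close>
    by (intro exI[of _ "Letter (if a = 0 then 1 else if a = 1 then 2 else 0)"])
      (auto simp: complete_on_letters_def)
qed

theorem corollary2p2:
  fixes d n :: nat
  assumes "d \<ge> 2" and "n \<ge> 1"
  shows "metric_dimension (with_proj (de_bruijn d n)) = d ^ (n - 1) * (d - 1) \<and>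
         metric_dimension (with_proj (kautz d n)) =
           (if n = 1 then d else d ^ (n - 2) * (d\<^sup>2 - 1))"
proof (cases "n = 1")
  case True
  interpret K: pair_fin_digraph "complete_on_letters (d + 1)"
    by (rule pair_fin_digraph_complete_on_letters)
  interpret B: pair_fin_digraph "add_loops (complete_on_letters d)"
    by (intro pair_fin_digraph_add_loops pair_fin_digraph_complete_on_letters)
  \<comment> \<open>For \<open>n = 1\<close> neither digraph arises from \<open>line\<close>; both
    are complete up to loops.\<close>
  have "metric_dimension (add_loops (complete_on_letters d)) = d - 1"
    using assms
    by (subst B.metric_dimension_complete)
      (auto simp: card_pverts_complete_on_letters,
        auto simp: add_loops_def complete_on_letters_def lessThan_empty_iff)
  moreover have "metric_dimension (complete_on_letters (d + 1)) = d"
    by (subst K.metric_dimension_complete)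
      (auto simp: card_pverts_complete_on_letters, auto simp: complete_on_letters_def)
  ultimately show ?thesis using True by simp
next
  case False
  then obtain m where m: "n = Suc (Suc m)"
    using assms(2) by (cases n rule: nat.exhaust; cases "n - 1") auto
  \<comment> \<open>The last factor counts the letters of the starting digraph; with
    \<open>m = n - 2\<close> it raises the power of \<open>d\<close> to
    \<open>n - 1\<close>.\<close>
  have B: "metric_dimension (de_bruijn d n) = d ^ m * (d - 1) * d"
    unfolding m
    by (subst iterated_line[where F = "de_bruijn d" and d = d])
      (use assms regular_add_loops_complete sparing_choice_add_loops_complete in
        \<open>auto simp: card_pverts_complete_on_letters\<close>)
  \<comment> \<open>The Kautz family starts with \<open>d + 1\<close> letters of degree
    \<open>d\<close>, and \<open>d \<ge> 2\<close> supplies the three letters that the choice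
    requires.\<close>
  have "metric_dimension (kautz d n) = d ^ m * ((d - 1) * (d + 1))"
    unfolding m mult.assoc[symmetric]
    using regular_complete_on_letters sparing_choice_complete_on_letters[of "d + 1"] assms
    by (subst iterated_line[where F = "kautz d" and d = d])
      (auto simp: card_pverts_complete_on_letters)
  also have "(d - 1) * (d + 1) = d\<^sup>2 - 1"
    by (simp add: power2_eq_square diff_mult_distrib algebra_simps)
  finally show ?thesis
    using B m by (simp add: mult.assoc mult.commute)
qed

end
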